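(* Let $(A,\cdot,\circ)$ be a transposed Novikov-Poisson algebra over $\mathbf{k}$ and let $p\in A$. If the left multiplication $L_\cdot(p):A\to A$, $x\mapsto p\cdot x$, is an algebra homomorphism of $(A,\circ)$, then $(A,\circ,L_\cdot(p))$ is a Hom-Novikov algebra.
   Context: $\mathbf{k}$ is a field of characteristic not equal to $2$; all binary operations are $\mathbf{k}$-bilinear and algebras need not be unital. A (left) Novikov algebra $(A,\circ)$ is a vector space with a binary operation satisfying $(x\circ y)\circ z=(x\circ z)\circ y$ and $(x\circ y)\circ z-x\circ(y\circ z)=(y\circ x)\circ z-y\circ(x\circ z)$ for all $x,y,z$. A transposed Novikov-Poisson algebra is a triple $(A,\cdot,\circ)$ where $(A,\cdot)$ is a commutative associative algebra, $(A,\circ)$ is a Novikov algebra, and for all $x,y,z\in A$: $(x\cdot y)\circ z=(x\cdot z)\circ y$ and $2z\cdot(x\circ y)=(z\cdot x)\circ y+x\circ(z\cdot y)$. A Hom-Novikov algebra is a triple $(A,\circ,\alpha)$ consisting of a vector space $A$, a binary operation $\circ$ and an algebra homomorphism $\alpha:A\to A$ (linear with $\alpha(x\circ y)=\alpha(x)\circ\alpha(y)$) such that for all $x,y,z\in A$: $(x\circ y)\circ\alpha(z)-\alpha(x)\circ(y\circ z)=(y\circ x)\circ\alpha(z)-\alpha(y)\circ(x\circ z)$ and $(x\circ y)\circ\alpha(z)=(x\circ z)\circ\alpha(y)$. *)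

theory Defs
  imports Complex_Main
begin

text \<open>
  The underlying vector space of an algebra is a whole type, with the scalar action of the field
  given explicitly as in \<^locale>\<open>vector_space\<close>. Algebras need not be unital, nor associative
  unless stated.
\<close>

locale bilinear_algebra = vector_space scale
  for scale :: "'k::field \<Rightarrow> 'a::ab_group_add \<Rightarrow> 'a" +
  fixes mult :: "'a \<Rightarrow> 'a \<Rightarrow> 'a"
  assumes linear_right: "Vector_Spaces.linear scale scale (\<lambda>y. mult x y)"
    and linear_left: "Vector_Spaces.linear scale scale (\<lambda>x. mult x y)"

locale commutative_associative_algebra = bilinear_algebra scale mult
  for scale :: "'k::field \<Rightarrow> 'a::ab_group_add \<Rightarrow> 'a"
    and mult :: "'a \<Rightarrow> 'a \<Rightarrow> 'a" (infixl "\<cdot>" 70) +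
  assumes commute: "x \<cdot> y = y \<cdot> x"
    and assoc: "(x \<cdot> y) \<cdot> z = x \<cdot> (y \<cdot> z)"

locale novikov_algebra = bilinear_algebra scale circ
  for scale :: "'k::field \<Rightarrow> 'a::ab_group_add \<Rightarrow> 'a"
    and circ :: "'a \<Rightarrow> 'a \<Rightarrow> 'a" (infixl "\<odot>" 70) +
  assumes right_commute: "(x \<odot> y) \<odot> z = (x \<odot> z) \<odot> y"
    and left_symmetric:
      "(x \<odot> y) \<odot> z - x \<odot> (y \<odot> z) = (y \<odot> x) \<odot> z - y \<odot> (x \<odot> z)"

locale transposed_novikov_poisson_algebra =
  dot: commutative_associative_algebra scale dot + circ: novikov_algebra scale circ
  for scale :: "'k::field \<Rightarrow> 'a::ab_group_add \<Rightarrow> 'a" (infixr "*s" 75)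
    and dot :: "'a \<Rightarrow> 'a \<Rightarrow> 'a" (infixl "\<cdot>" 70)
    and circ :: "'a \<Rightarrow> 'a \<Rightarrow> 'a" (infixl "\<odot>" 70) +
  assumes dot_circ_commute: "(x \<cdot> y) \<odot> z = (x \<cdot> z) \<odot> y"
    and transposed_leibniz: "2 *s (z \<cdot> (x \<odot> y)) = (z \<cdot> x) \<odot> y + x \<odot> (z \<cdot> y)"

locale algebra_endomorphism = bilinear_algebra scale mult
  for scale :: "'k::field \<Rightarrow> 'a::ab_group_add \<Rightarrow> 'a"
    and mult :: "'a \<Rightarrow> 'a \<Rightarrow> 'a" +
  fixes \<alpha> :: "'a \<Rightarrow> 'a"
  assumes linear: "Vector_Spaces.linear scale scale \<alpha>"
    and map_mult: "\<alpha> (mult x y) = mult (\<alpha> x) (\<alpha> y)"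

locale hom_novikov_algebra = algebra_endomorphism scale circ \<alpha>
  for scale :: "'k::field \<Rightarrow> 'a::ab_group_add \<Rightarrow> 'a"
    and circ :: "'a \<Rightarrow> 'a \<Rightarrow> 'a" (infixl "\<odot>" 70)
    and \<alpha> :: "'a \<Rightarrow> 'a" +
  assumes hom_left_symmetric:
      "(x \<odot> y) \<odot> \<alpha> z - \<alpha> x \<odot> (y \<odot> z) = (y \<odot> x) \<odot> \<alpha> z - \<alpha> y \<odot> (x \<odot> z)"
    and hom_right_commute: "(x \<odot> y) \<odot> \<alpha> z = (x \<odot> z) \<odot> \<alpha> y"

end

theory Submission
  imports Defs
begin

text \<open>
  Write \<open>\<alpha> = L(p)\<close>. Both Hom-identities come from the same device: the transposed Leibniz rule at
  \<open>p\<close> moves the factor \<open>p\<close> around inside a nested product, and comparing the resulting expansion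
  with its image under a transposition of two arguments makes all terms cancel except the wanted
  ones.

  For right commutativity, \<open>4 p \<cdot> ((x \<odot> y) \<odot> z)\<close> is symmetric in \<open>y\<close> and \<open>z\<close>, and it expands to
  \<open>((p \<cdot> x) \<odot> y) \<odot> z + (x \<odot> z) \<odot> (p \<cdot> y) + 2 ((x \<odot> y) \<odot> (p \<cdot> z))\<close>. Subtracting the mirror
  image leaves \<open>(x \<odot> y) \<odot> (p \<cdot> z) - (x \<odot> z) \<odot> (p \<cdot> y) = 0\<close> (\<open>circ_circ_dot_commute\<close>).

  For left symmetry, multiplicativity of \<open>\<alpha>\<close> has a strong effect: together with
  \<open>(p \<cdot> w) \<odot> x = (p \<cdot> x) \<odot> w\<close> it yields
  \<open>\<alpha> x \<odot> (y \<odot> z) = \<alpha> (y \<odot> z) \<odot> x = (\<alpha> y \<odot> \<alpha> z) \<odot> x = (\<alpha> y \<odot> x) \<odot> \<alpha> z\<close>, which is symmetric in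
  \<open>x\<close> and \<open>y\<close> (\<open>dot_circ_circ_commute\<close>). Expanding \<open>2 \<alpha> (y \<odot> z) \<odot> x\<close> by the Leibniz rule instead
  shows that \<open>(y \<odot> x) \<odot> \<alpha> z\<close> is symmetric as well (\<open>circ_commute_circ_dot\<close>). So the two sides of
  the Hom-identity agree term by term.
\<close>

lemma (in bilinear_algebra) mult_add_left: "mult (x + y) z = mult x z + mult y z"
  using linear_left by (simp add: Vector_Spaces.linear_iff)

context transposed_novikov_poisson_algebra
begin

lemma leibniz_sum: "z \<cdot> (x \<odot> y) + z \<cdot> (x \<odot> y) = (z \<cdot> x) \<odot> y + x \<odot> (z \<cdot> y)"
  using transposed_leibniz[of z x y]
    dot.scale_left_distrib[of 1 1 "z \<cdot> (x \<odot> y)"] by simp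

text \<open>
  The Leibniz rule multiplied by \<open>x\<close> on the right; right commutativity then brings \<open>z\<close>, or
  \<open>p \<cdot> z\<close>, to the outermost position.
\<close>

lemma double_dot_circ_circ:
  "(p \<cdot> (y \<odot> z)) \<odot> x + (p \<cdot> (y \<odot> z)) \<odot> x
    = ((p \<cdot> y) \<odot> x) \<odot> z + (y \<odot> x) \<odot> (p \<cdot> z)"
proof -
  have "(p \<cdot> (y \<odot> z)) \<odot> x + (p \<cdot> (y \<odot> z)) \<odot> x = ((p \<cdot> y) \<odot> z) \<odot> x + (y \<odot> (p \<cdot> z)) \<odot> x"
    by (simp add: leibniz_sum flip: circ.mult_add_left)
  then show ?thesis
    by (simp add: circ.right_commute[of _ _ x])
qed

text \<open>
  Two applications of the Leibniz rule to \<open>4 p \<cdot> ((x \<odot> y) \<odot> z)\<close>; since the left-hand side and the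
  first summand on the right are symmetric in \<open>y\<close> and \<open>z\<close>, so is the rest, and this rest contains
  \<open>(x \<odot> y) \<odot> (p \<cdot> z)\<close> once more often than its mirror image.
\<close>

lemma circ_circ_dot_commute: "(x \<odot> y) \<odot> (p \<cdot> z) = (x \<odot> z) \<odot> (p \<cdot> y)"
proof -
  have expand: "(p \<cdot> ((x \<odot> y) \<odot> z) + p \<cdot> ((x \<odot> y) \<odot> z)) + (p \<cdot> ((x \<odot> y) \<odot> z) + p \<cdot> ((x \<odot> y) \<odot> z))
      = ((p \<cdot> x) \<odot> y) \<odot> z + (x \<odot> z) \<odot> (p \<cdot> y) + (x \<odot> y) \<odot> (p \<cdot> z) + (x \<odot> y) \<odot> (p \<cdot> z)"
    (is "?lhs = _") for y z
  proof -
    have "?lhs = ((p \<cdot> (x \<odot> y)) \<odot> z + (p \<cdot> (x \<odot> y)) \<odot> z) + ((x \<odot> y) \<odot> (p \<cdot> z) + (x \<odot> y) \<odot> (p \<cdot> z))"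
      unfolding leibniz_sum by (simp add: algebra_simps)
    then show ?thesis
      unfolding double_dot_circ_circ circ.right_commute[of "p \<cdot> x" z y] by (simp add: algebra_simps)
  qed
  show ?thesis
    using expand[of y z] expand[of z y]
    unfolding circ.right_commute[of x z y] circ.right_commute[of "p \<cdot> x" z y]
    by (simp add: algebra_simps)
qed

text \<open>
  Both sides equal \<open>((p \<cdot> y) \<odot> x) \<odot> (p \<cdot> z)\<close>, and \<open>(p \<cdot> y) \<odot> x = (p \<cdot> x) \<odot> y\<close>.
\<close>

lemma dot_circ_circ_commute:
  assumes hom: "\<And>x y. p \<cdot> (x \<odot> y) = (p \<cdot> x) \<odot> (p \<cdot> y)"
  shows "(p \<cdot> x) \<odot> (y \<odot> z) = (p \<cdot> y) \<odot> (x \<odot> z)"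
proof -
  have "(p \<cdot> x) \<odot> (y \<odot> z) = ((p \<cdot> y) \<odot> x) \<odot> (p \<cdot> z)" for x y
    by (metis hom dot_circ_commute circ.right_commute)
  then show ?thesis
    by (metis dot_circ_commute)
qed

text \<open>
  In the doubled identity for \<open>(p \<cdot> (y \<odot> z)) \<odot> x = (p \<cdot> x) \<odot> (y \<odot> z)\<close> everything except
  \<open>(y \<odot> x) \<odot> (p \<cdot> z)\<close> is now known to be symmetric in \<open>x\<close> and \<open>y\<close>.
\<close>

lemma circ_commute_circ_dot:
  assumes hom: "\<And>x y. p \<cdot> (x \<odot> y) = (p \<cdot> x) \<odot> (p \<cdot> y)"
  shows "(x \<odot> y) \<odot> (p \<cdot> z) = (y \<odot> x) \<odot> (p \<cdot> z)"
proof -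
  have "(p \<cdot> (y \<odot> z)) \<odot> x = (p \<cdot> (x \<odot> z)) \<odot> y"
    using dot_circ_circ_commute[OF hom] by (metis dot_circ_commute)
  then have "((p \<cdot> y) \<odot> x) \<odot> z + (y \<odot> x) \<odot> (p \<cdot> z) = ((p \<cdot> x) \<odot> y) \<odot> z + (x \<odot> y) \<odot> (p \<cdot> z)"
    by (simp flip: double_dot_circ_circ)
  then show ?thesis
    by (simp add: dot_circ_commute[of p y x])
qed

end

theorem proposition3p8:
  fixes scale :: "'k::field \<Rightarrow> 'a::ab_group_add \<Rightarrow> 'a"
    and dot circ :: "'a \<Rightarrow> 'a \<Rightarrow> 'a"
    and p :: 'a
  assumes "CHAR('k) \<noteq> 2"
    and "transposed_novikov_poisson_algebra scale dot circ"
    and "algebra_endomorphism scale circ (\<lambda>x. dot p x)"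
  shows "hom_novikov_algebra scale circ (\<lambda>x. dot p x)"
proof -
  interpret transposed_novikov_poisson_algebra scale dot circ by fact
  interpret endo: algebra_endomorphism scale circ "\<lambda>x. dot p x" by fact
  show ?thesis
  proof
    fix x y z
    show "circ (circ x y) (dot p z) - circ (dot p x) (circ y z)
        = circ (circ y x) (dot p z) - circ (dot p y) (circ x z)"
      using circ_commute_circ_dot[OF endo.map_mult] dot_circ_circ_commute[OF endo.map_mult]
      by metis
    show "circ (circ x y) (dot p z) = circ (circ x z) (dot p y)"
      by (rule circ_circ_dot_commute)
  qed
qed

end
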